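(* Let $\mathcal{X}$ be a separable normed space. Then: (i) the space $\mathcal{X}\oplus_\infty c_0$ admits a tiling by balls if and only if $\mathcal{X}$ admits a tiling by balls; (ii) if $\mathcal{X}$ has at most countable (algebraic) dimension, then $\mathcal{X}\oplus_\infty c_{00}$ admits a star-finite tiling by balls.
   Context: All normed spaces are real and non-trivial ($\neq\{0\}$), and not necessarily complete. $c_0$ is the space of real null sequences and $c_{00}$ the space of finitely supported real sequences, both with the supremum norm. $\mathcal{X}\oplus_\infty\mathcal{V}$ denotes $\mathcal{X}\times\mathcal{V}$ with norm $\|(x,v)\|=\max\{\|x\|,\|v\|\}$. A ball is a closed ball of positive radius. A family $\mathcal{F}$ of non-empty subsets of a normed space is a covering if its union is the whole space; it is non-overlapping if its (distinct) elements have mutually disjoint interiors; it is a tiling if it is a non-overlapping covering and each element is a closed convex set with non-empty interior. A tiling by balls is a tiling all of whose elements are balls (the radii may vary). $\mathcal{F}$ is star-finite if each element of $\mathcal{F}$ intersects only finitely many elements of $\mathcal{F}$. *)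

theory Defs
  imports "HOL-Analysis.Analysis"
begin

section \<open>The sequence spaces \<open>c\<^sub>0\<close> and \<open>c\<^sub>0\<^sub>0\<close>\<close>

lemma SUP_abs_norm_facts:
  fixes f g :: "nat \<Rightarrow> real" and a :: real
  assumes f: "bounded (range f)" and g: "bounded (range g)"
  shows "\<bar>f n\<bar> \<le> (SUP n. \<bar>f n\<bar>)"
    and "(SUP n. \<bar>f n\<bar>) = 0 \<longleftrightarrow> f = (\<lambda>_. 0)"
    and "(SUP n. \<bar>f n + g n\<bar>) \<le> (SUP n. \<bar>f n\<bar>) + (SUP n. \<bar>g n\<bar>)"
    and "(SUP n. \<bar>a * f n\<bar>) = \<bar>a\<bar> * (SUP n. \<bar>f n\<bar>)"
proof -
  have bdd: "bdd_above (range (\<lambda>n. \<bar>h n\<bar>))" if "bounded (range h)" for h :: "nat \<Rightarrow> real"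
    using that unfolding bounded_iff bdd_above_def by auto
  have upper: "\<bar>h n\<bar> \<le> (SUP n. \<bar>h n\<bar>)" if "bounded (range h)" for h :: "nat \<Rightarrow> real" and n
    by (rule cSUP_upper[OF _ bdd[OF that]]) simp
  show "\<bar>f n\<bar> \<le> (SUP n. \<bar>f n\<bar>)"
    by (rule upper[OF f])
  show "(SUP n. \<bar>f n\<bar>) = 0 \<longleftrightarrow> f = (\<lambda>_. 0)"
  proof
    assume "(SUP n. \<bar>f n\<bar>) = 0"
    then have "\<bar>f n\<bar> \<le> 0" for n
      using upper[OF f, of n] by simp
    then show "f = (\<lambda>_. 0)" by auto
  qed simp
  show "(SUP n. \<bar>f n + g n\<bar>) \<le> (SUP n. \<bar>f n\<bar>) + (SUP n. \<bar>g n\<bar>)"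
  proof (rule cSUP_least)
    fix n
    show "\<bar>f n + g n\<bar> \<le> (SUP n. \<bar>f n\<bar>) + (SUP n. \<bar>g n\<bar>)"
      using upper[OF f, of n] upper[OF g, of n] by linarith
  qed simp
  show "(SUP n. \<bar>a * f n\<bar>) = \<bar>a\<bar> * (SUP n. \<bar>f n\<bar>)"
  proof (cases "a = 0")
    case False
    have "bounded (range (\<lambda>n. a * f n))"
      using bounded_scaling[OF f, of a] by (simp add: image_image)
    note af = upper[OF this]
    have "(SUP n. \<bar>f n\<bar>) \<le> (SUP n. \<bar>a * f n\<bar>) / \<bar>a\<bar>"
    proof (rule cSUP_least)
      fix n
      show "\<bar>f n\<bar> \<le> (SUP n. \<bar>a * f n\<bar>) / \<bar>a\<bar>"
        using af[of n] False by (simp add: field_simps abs_mult)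
    qed simp
    moreover have "(SUP n. \<bar>a * f n\<bar>) \<le> \<bar>a\<bar> * (SUP n. \<bar>f n\<bar>)"
      by (rule cSUP_least) (auto simp: abs_mult intro!: mult_left_mono upper[OF f])
    ultimately show ?thesis
      using False by (simp add: field_simps)
  qed simp
qed

typedef c0 = "{f :: nat \<Rightarrow> real. f \<longlonglongrightarrow> 0}"
  morphisms c0_nth Abs_c0
  by (rule exI[of _ "\<lambda>_. 0"]) simp

setup_lifting type_definition_c0

lemma bounded_c0_nth: "bounded (range (c0_nth x))"
  using c0_nth[of x] by (auto intro: convergent_imp_bounded)

instantiation c0 :: real_vector
begin

lift_definition zero_c0 :: c0 is "\<lambda>_. 0" by simp
lift_definition plus_c0 :: "c0 \<Rightarrow> c0 \<Rightarrow> c0" is "\<lambda>f g n. f n + g n"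
  by (rule tendsto_add_zero)
lift_definition uminus_c0 :: "c0 \<Rightarrow> c0" is "\<lambda>f n. - f n"
  using tendsto_minus by fastforce
lift_definition minus_c0 :: "c0 \<Rightarrow> c0 \<Rightarrow> c0" is "\<lambda>f g n. f n - g n"
  using tendsto_diff by fastforce
lift_definition scaleR_c0 :: "real \<Rightarrow> c0 \<Rightarrow> c0" is "\<lambda>a f n. a * f n"
  by (rule tendsto_mult_right_zero)

instance
proof
  fix x y z :: c0 and a b :: real
  show "x + y + z = x + (y + z)" by transfer (simp add: add.assoc)
  show "x + y = y + x" by transfer (simp add: add.commute)
  show "0 + x = x" by transfer simp
  show "- x + x = 0" by transfer simp
  show "x - y = x + - y" by transfer simp
  show "a *\<^sub>R (x + y) = a *\<^sub>R x + a *\<^sub>R y" by transfer (simp add: algebra_simps)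
  show "(a + b) *\<^sub>R x = a *\<^sub>R x + b *\<^sub>R x" by transfer (simp add: algebra_simps)
  show "a *\<^sub>R b *\<^sub>R x = (a * b) *\<^sub>R x" by transfer (simp add: mult.assoc)
  show "1 *\<^sub>R x = x" by transfer simp
qed

end

instantiation c0 :: real_normed_vector
begin

lift_definition norm_c0 :: "c0 \<Rightarrow> real" is "\<lambda>f. SUP n. \<bar>f n\<bar>" .

definition dist_c0 :: "c0 \<Rightarrow> c0 \<Rightarrow> real"
  where "dist_c0 x y = norm (x - y)"
definition sgn_c0 :: "c0 \<Rightarrow> c0"
  where "sgn_c0 x = x /\<^sub>R norm x"
definition uniformity_c0 :: "(c0 \<times> c0) filter"
  where "uniformity_c0 = (INF e\<in>{0<..}. principal {(x, y). dist x y < e})"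
definition open_c0 :: "c0 set \<Rightarrow> bool"
  where "open_c0 U = (\<forall>x\<in>U. eventually (\<lambda>(x', y). x' = x \<longrightarrow> y \<in> U) uniformity)"

instance
proof
  fix x y :: "c0" and a :: real
  note facts = SUP_abs_norm_facts[OF bounded_c0_nth[of x] bounded_c0_nth[of y]]
  show "sgn x = x /\<^sub>R norm x" by (rule sgn_c0_def)
  show "dist x y = norm (x - y)" by (rule dist_c0_def)
  show "norm x = 0 \<longleftrightarrow> x = 0"
    using facts(2) by (simp add: norm_c0.rep_eq zero_c0.rep_eq flip: c0_nth_inject)
  show "norm (x + y) \<le> norm x + norm y"
    using facts(3) by (simp add: norm_c0.rep_eq plus_c0.rep_eq)
  show "norm (a *\<^sub>R x) = \<bar>a\<bar> * norm x"
    using facts(4) by (simp add: norm_c0.rep_eq scaleR_c0.rep_eq)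
qed (rule uniformity_c0_def open_c0_def)+

end

typedef c00 = "{f :: nat \<Rightarrow> real. finite {n. f n \<noteq> 0}}"
  morphisms c00_nth Abs_c00
  by (rule exI[of _ "\<lambda>_. 0"]) simp

setup_lifting type_definition_c00

lemma bounded_c00_nth: "bounded (range (c00_nth x))"
proof (rule finite_imp_bounded)
  have "range (c00_nth x) \<subseteq> insert 0 (c00_nth x ` {n. c00_nth x n \<noteq> 0})" by auto
  moreover have "finite {n. c00_nth x n \<noteq> 0}" using c00_nth[of x] by simp
  ultimately show "finite (range (c00_nth x))"
    by (meson finite_imageI finite_insert finite_subset)
qed

instantiation c00 :: real_vector
begin

lift_definition zero_c00 :: c00 is "\<lambda>_. 0" by simp
lift_definition plus_c00 :: "c00 \<Rightarrow> c00 \<Rightarrow> c00" is "\<lambda>f g n. f n + g n"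
  subgoal for f g
    by (rule finite_subset[of _ "{n. f n \<noteq> 0} \<union> {n. g n \<noteq> 0}"]) auto
  done
lift_definition uminus_c00 :: "c00 \<Rightarrow> c00" is "\<lambda>f n. - f n" by simp
lift_definition minus_c00 :: "c00 \<Rightarrow> c00 \<Rightarrow> c00" is "\<lambda>f g n. f n - g n"
  subgoal for f g
    by (rule finite_subset[of _ "{n. f n \<noteq> 0} \<union> {n. g n \<noteq> 0}"]) auto
  done
lift_definition scaleR_c00 :: "real \<Rightarrow> c00 \<Rightarrow> c00" is "\<lambda>a f n. a * f n"
  subgoal for a f
    by (rule finite_subset[of _ "{n. f n \<noteq> 0}"]) auto
  done

instance
proof
  fix x y z :: c00 and a b :: real
  show "x + y + z = x + (y + z)" by transfer (simp add: add.assoc)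
  show "x + y = y + x" by transfer (simp add: add.commute)
  show "0 + x = x" by transfer simp
  show "- x + x = 0" by transfer simp
  show "x - y = x + - y" by transfer simp
  show "a *\<^sub>R (x + y) = a *\<^sub>R x + a *\<^sub>R y" by transfer (simp add: algebra_simps)
  show "(a + b) *\<^sub>R x = a *\<^sub>R x + b *\<^sub>R x" by transfer (simp add: algebra_simps)
  show "a *\<^sub>R b *\<^sub>R x = (a * b) *\<^sub>R x" by transfer (simp add: mult.assoc)
  show "1 *\<^sub>R x = x" by transfer simp
qed

end

instantiation c00 :: real_normed_vector
begin

lift_definition norm_c00 :: "c00 \<Rightarrow> real" is "\<lambda>f. SUP n. \<bar>f n\<bar>" .

definition dist_c00 :: "c00 \<Rightarrow> c00 \<Rightarrow> real"
  where "dist_c00 x y = norm (x - y)"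
definition sgn_c00 :: "c00 \<Rightarrow> c00"
  where "sgn_c00 x = x /\<^sub>R norm x"
definition uniformity_c00 :: "(c00 \<times> c00) filter"
  where "uniformity_c00 = (INF e\<in>{0<..}. principal {(x, y). dist x y < e})"
definition open_c00 :: "c00 set \<Rightarrow> bool"
  where "open_c00 U = (\<forall>x\<in>U. eventually (\<lambda>(x', y). x' = x \<longrightarrow> y \<in> U) uniformity)"

instance
proof
  fix x y :: "c00" and a :: real
  note facts = SUP_abs_norm_facts[OF bounded_c00_nth[of x] bounded_c00_nth[of y]]
  show "sgn x = x /\<^sub>R norm x" by (rule sgn_c00_def)
  show "dist x y = norm (x - y)" by (rule dist_c00_def)
  show "norm x = 0 \<longleftrightarrow> x = 0"
    using facts(2) by (simp add: norm_c00.rep_eq zero_c00.rep_eq flip: c00_nth_inject)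
  show "norm (x + y) \<le> norm x + norm y"
    using facts(3) by (simp add: norm_c00.rep_eq plus_c00.rep_eq)
  show "norm (a *\<^sub>R x) = \<bar>a\<bar> * norm x"
    using facts(4) by (simp add: norm_c00.rep_eq scaleR_c00.rep_eq)
qed (rule uniformity_c00_def open_c00_def)+

end

section \<open>The \<open>\<infinity>\<close>-sum of two normed spaces\<close>

text \<open>
  A copy of the product type is needed, because the library norm on \<open>'a \<times> 'b\<close> is the Euclidean
  combination of the two norms, which has different balls.
\<close>

typedef ('a, 'b) linf_sum (infixr \<open>\<oplus>\<^sub>\<infinity>\<close> 20) = "UNIV :: ('a \<times> 'b) set"
  morphisms pair_of_linf_sum Abs_linf_sum
  by simp

setup_lifting type_definition_linf_sum

instantiation linf_sum :: (real_vector, real_vector) real_vector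
begin

lift_definition zero_linf_sum :: "('a, 'b) linf_sum" is "(0, 0)" .
lift_definition plus_linf_sum :: "('a, 'b) linf_sum \<Rightarrow> ('a, 'b) linf_sum \<Rightarrow> ('a, 'b) linf_sum"
  is "\<lambda>p q. (fst p + fst q, snd p + snd q)" .
lift_definition uminus_linf_sum :: "('a, 'b) linf_sum \<Rightarrow> ('a, 'b) linf_sum"
  is "\<lambda>p. (- fst p, - snd p)" .
lift_definition minus_linf_sum :: "('a, 'b) linf_sum \<Rightarrow> ('a, 'b) linf_sum \<Rightarrow> ('a, 'b) linf_sum"
  is "\<lambda>p q. (fst p - fst q, snd p - snd q)" .
lift_definition scaleR_linf_sum :: "real \<Rightarrow> ('a, 'b) linf_sum \<Rightarrow> ('a, 'b) linf_sum"
  is "\<lambda>a p. (a *\<^sub>R fst p, a *\<^sub>R snd p)" .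

instance
proof
  fix x y z :: "('a, 'b) linf_sum" and a b :: real
  show "x + y + z = x + (y + z)" by transfer (simp add: add.assoc)
  show "x + y = y + x" by transfer (simp add: add.commute)
  show "0 + x = x" by transfer simp
  show "- x + x = 0" by transfer simp
  show "x - y = x + - y" by transfer simp
  show "a *\<^sub>R (x + y) = a *\<^sub>R x + a *\<^sub>R y" by transfer (simp add: algebra_simps)
  show "(a + b) *\<^sub>R x = a *\<^sub>R x + b *\<^sub>R x" by transfer (simp add: algebra_simps)
  show "a *\<^sub>R b *\<^sub>R x = (a * b) *\<^sub>R x" by transfer (simp add: mult.assoc)
  show "1 *\<^sub>R x = x" by transfer simp
qed

end

instantiation linf_sum :: (real_normed_vector, real_normed_vector) real_normed_vector
begin

lift_definition norm_linf_sum :: "('a, 'b) linf_sum \<Rightarrow> real"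
  is "\<lambda>p. max (norm (fst p)) (norm (snd p))" .

definition dist_linf_sum :: "('a, 'b) linf_sum \<Rightarrow> ('a, 'b) linf_sum \<Rightarrow> real"
  where "dist_linf_sum x y = norm (x - y)"
definition sgn_linf_sum :: "('a, 'b) linf_sum \<Rightarrow> ('a, 'b) linf_sum"
  where "sgn_linf_sum x = x /\<^sub>R norm x"
definition uniformity_linf_sum :: "(('a, 'b) linf_sum \<times> ('a, 'b) linf_sum) filter"
  where "uniformity_linf_sum = (INF e\<in>{0<..}. principal {(x, y). dist x y < e})"
definition open_linf_sum :: "('a, 'b) linf_sum set \<Rightarrow> bool"
  where "open_linf_sum U = (\<forall>x\<in>U. eventually (\<lambda>(x', y). x' = x \<longrightarrow> y \<in> U) uniformity)"

instance
proof
  fix x y :: "('a, 'b) linf_sum" and a :: real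
  show "sgn x = x /\<^sub>R norm x" by (rule sgn_linf_sum_def)
  show "dist x y = norm (x - y)" by (rule dist_linf_sum_def)
  show "norm x = 0 \<longleftrightarrow> x = 0"
    by transfer (auto simp: max_def prod_eq_iff)
  show "norm (x + y) \<le> norm x + norm y"
  proof transfer
    fix p q :: "'a \<times> 'b"
    show "max (norm (fst (fst p + fst q, snd p + snd q))) (norm (snd (fst p + fst q, snd p + snd q)))
        \<le> max (norm (fst p)) (norm (snd p)) + max (norm (fst q)) (norm (snd q))"
      using norm_triangle_ineq[of "fst p" "fst q"] norm_triangle_ineq[of "snd p" "snd q"] by auto
  qed
  show "norm (a *\<^sub>R x) = \<bar>a\<bar> * norm x"
    by transfer (simp add: max_mult_distrib_left)
qed (rule uniformity_linf_sum_def open_linf_sum_def)+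

end

section \<open>Tilings\<close>

definition covering :: "'a set set \<Rightarrow> bool"
  where "covering F \<longleftrightarrow> (\<forall>A\<in>F. A \<noteq> {}) \<and> \<Union>F = UNIV"

definition non_overlapping :: "'a::topological_space set set \<Rightarrow> bool"
  where "non_overlapping F \<longleftrightarrow> pairwise (\<lambda>A B. disjnt (interior A) (interior B)) F"

definition tiling :: "'a::real_normed_vector set set \<Rightarrow> bool"
  where "tiling F \<longleftrightarrow>
    covering F \<and> non_overlapping F \<and> (\<forall>A\<in>F. closed A \<and> convex A \<and> interior A \<noteq> {})"

definition is_ball :: "'a::real_normed_vector set \<Rightarrow> bool"
  where "is_ball A \<longleftrightarrow> (\<exists>x r. 0 < r \<and> A = cball x r)"

definition tiling_by_balls :: "'a::real_normed_vector set set \<Rightarrow> bool"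
  where "tiling_by_balls F \<longleftrightarrow> tiling F \<and> (\<forall>A\<in>F. is_ball A)"

definition star_finite :: "'a set set \<Rightarrow> bool"
  where "star_finite F \<longleftrightarrow> (\<forall>A\<in>F. finite {B\<in>F. A \<inter> B \<noteq> {}})"

definition countable_algebraic_dimension :: "'a::real_vector itself \<Rightarrow> bool"
  where "countable_algebraic_dimension _ \<longleftrightarrow>
    (\<exists>B :: 'a set. independent B \<and> span B = UNIV \<and> countable B)"

end

theory Submission
  imports Defs
begin

text \<open>
  (i) Each ball \<open>cball x r\<close> tiling \<open>X\<close> is multiplied by the cubes of radius \<open>r\<close> centered at the grid
  \<open>2 r \<int>\<^sup>\<nat> \<inter> c\<^sub>0\<close>. Conversely, by separability a tiling of \<open>X \<oplus>\<^sub>\<infinity> c\<^sub>0\<close> is countable, so some level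
  \<open>v \<in> c\<^sub>0\<close> lies on no sphere bounding the \<open>c\<^sub>0\<close>-component of a tile, and the slice at \<open>v\<close> tiles \<open>X\<close>.

  (ii) The space \<open>X \<oplus>\<^sub>\<infinity> c\<^sub>0\<^sub>0\<close> is a countable union of compact sets \<open>K\<close>, each using finitely many
  coordinates of \<open>c\<^sub>0\<^sub>0\<close>. They are covered one after another. If the closed set \<open>C\<close> is already covered, the
  part of \<open>K\<close> outside \<open>C\<close> is covered by balls around points \<open>p\<close> with radius a third of the distance
  \<open>\<delta> p\<close> to \<open>C\<close>, with only finitely many \<open>p\<close> satisfying \<open>\<delta> p \<ge> \<eta>\<close> for each \<open>\<eta> > 0\<close>. These
  balls may overlap, but moving their centers in coordinates not used by \<open>K\<close> makes the interiors disjoint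
  without changing the traces on \<open>K\<close>. The new tiles stay away from \<open>C\<close>, intersecting tiles have
  comparable radii (hence star-finiteness), and \<open>C\<close> together with the new tiles is closed.
\<close>

section \<open>Tilings by balls\<close>

text \<open>An interior point \<open>z \<noteq> c\<close> can be pushed a further distance
  \<open>e\<close> along the ray from \<open>c\<close> without leaving the ball, so
  \<open>norm (z - c) + e \<le> r\<close>.\<close>

lemma interior_cball_normed:
  fixes c :: "'a::real_normed_vector"
  assumes r: "0 < r"
  shows "interior (cball c r) = ball c r"
proof
  show "interior (cball c r) \<subseteq> ball c r"
  proof
    fix z assume "z \<in> interior (cball c r)"
    then obtain e where e: "0 < e" "cball z e \<subseteq> cball c r"
      by (auto simp: mem_interior_cball)
    show "z \<in> ball c r"
    proof (cases "z = c")
      case False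
      define n where "n = norm (z - c)"
      have n: "0 < n" using False by (simp add: n_def)
      have "z + (e / n) *\<^sub>R (z - c) \<in> cball z e"
        using n e by (simp add: dist_norm flip: n_def)
      with e have "z + (e / n) *\<^sub>R (z - c) \<in> cball c r" by blast
      moreover have "c - (z + (e / n) *\<^sub>R (z - c)) = - ((1 + e / n) *\<^sub>R (z - c))"
        by (simp add: algebra_simps)
      ultimately have "\<bar>1 + e / n\<bar> * n \<le> r"
        by (simp add: dist_norm n_def)
      moreover have "\<bar>1 + e / n\<bar> * n = n + e"
        using n e by (simp add: field_simps)
      ultimately have "n < r" using e by linarith
      then show ?thesis by (simp add: n_def dist_norm norm_minus_commute)
    qed (use r in simp)
  qed
  show "ball c r \<subseteq> interior (cball c r)"
    by (simp add: interior_maximal ball_subset_cball)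
qed

lemma tiling_by_balls_iff:
  "tiling_by_balls F \<longleftrightarrow> \<Union>F = UNIV \<and> non_overlapping F \<and> (\<forall>A\<in>F. is_ball A)"
proof -
  have "A \<noteq> {} \<and> closed A \<and> convex A \<and> interior A \<noteq> {}" if "is_ball A" for A :: "'a set"
    using that by (auto simp: is_ball_def interior_cball_normed)
  then show ?thesis
    unfolding tiling_by_balls_def tiling_def covering_def by blast
qed

text \<open>Overlap has to force equal balls, not equal indices: the tiling is an image set, in
  which a repeated ball counts once.\<close>

lemma tiling_by_balls_parametrized:
  fixes c :: "'i \<Rightarrow> 'a::real_normed_vector" and r :: "'i \<Rightarrow> real"
  assumes r: "\<And>i. i \<in> I \<Longrightarrow> 0 < r i"
    and cover: "\<And>z. \<exists>i\<in>I. dist (c i) z \<le> r i"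
    and disj: "\<And>i j z. i \<in> I \<Longrightarrow> j \<in> I \<Longrightarrow> dist (c i) z < r i \<Longrightarrow> dist (c j) z < r j
      \<Longrightarrow> cball (c i) (r i) = cball (c j) (r j)"
  shows "tiling_by_balls ((\<lambda>i. cball (c i) (r i)) ` I)"
proof -
  have "(\<Union>i\<in>I. cball (c i) (r i)) = UNIV"
    using cover by force
  moreover have "disjnt (interior (cball (c i) (r i))) (interior (cball (c j) (r j)))"
    if "i \<in> I" "j \<in> I" "cball (c i) (r i) \<noteq> cball (c j) (r j)" for i j
    using that disj[OF that(1,2)] by (auto simp: disjnt_iff interior_cball_normed r)
  ultimately show ?thesis
    unfolding tiling_by_balls_iff non_overlapping_def pairwise_def is_ball_def
    using r by blast
qed

text \<open>Choosing a center and a radius for each tile turns the topological conditions into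
  distance inequalities, which can be split into components under the max norm.\<close>

lemma tiling_by_balls_centers:
  fixes F :: "'a::real_normed_vector set set"
  assumes "tiling_by_balls F"
  shows "\<exists>(c :: 'a set \<Rightarrow> 'a) r. (\<forall>A\<in>F. 0 < r A) \<and> (\<forall>z. \<exists>A\<in>F. dist (c A) z \<le> r A) \<and>
    (\<forall>A\<in>F. \<forall>B\<in>F. \<forall>z. dist (c A) z < r A \<longrightarrow> dist (c B) z < r B \<longrightarrow> A = B)"
proof -
  have F: "\<Union>F = UNIV" "non_overlapping F" "\<And>A. A \<in> F \<Longrightarrow> \<exists>x r. 0 < r \<and> A = cball x r"
    using assms by (auto simp: tiling_by_balls_iff is_ball_def)
  obtain c r where cr: "\<And>A. A \<in> F \<Longrightarrow> 0 < r A \<and> A = cball (c A) (r A)"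
    using F(3) by metis
  have "\<exists>A\<in>F. dist (c A) z \<le> r A" for z
  proof -
    obtain A where "A \<in> F" "z \<in> A" using F(1) by blast
    then have "z \<in> cball (c A) (r A)" using cr by blast
    with \<open>A \<in> F\<close> show ?thesis by auto
  qed
  moreover have "A = B"
    if "A \<in> F" "B \<in> F" "dist (c A) z < r A" "dist (c B) z < r B" for A B z
  proof (rule ccontr)
    assume "A \<noteq> B"
    then have "disjnt (interior A) (interior B)"
      using F(2) that by (auto simp: non_overlapping_def pairwise_def)
    moreover have "interior A = ball (c A) (r A)" "interior B = ball (c B) (r B)"
      using cr that by (metis interior_cball_normed)+
    ultimately show False using that by (auto simp: disjnt_iff)
  qed
  ultimately show ?thesis using cr by (intro exI[of _ c] exI[of _ r]) blast
qed

section \<open>Tilings of \<open>X \<oplus>\<^sub>\<infinity> c\<^sub>0\<close>\<close>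

definition linf_pair :: "'a \<Rightarrow> 'b \<Rightarrow> ('a \<oplus>\<^sub>\<infinity> 'b)"
  where "linf_pair x v = Abs_linf_sum (x, v)"
definition lfst :: "('a \<oplus>\<^sub>\<infinity> 'b) \<Rightarrow> 'a"
  where "lfst z = fst (pair_of_linf_sum z)"
definition lsnd :: "('a \<oplus>\<^sub>\<infinity> 'b) \<Rightarrow> 'b"
  where "lsnd z = snd (pair_of_linf_sum z)"

lemma lfst_pair [simp]: "lfst (linf_pair x v) = x"
  and lsnd_pair [simp]: "lsnd (linf_pair x v) = v"
  by (simp_all add: lfst_def lsnd_def linf_pair_def Abs_linf_sum_inverse)

lemma linf_sum_eq_iff: "z = w \<longleftrightarrow> lfst z = lfst w \<and> lsnd z = lsnd w"
  by (metis lfst_def lsnd_def pair_of_linf_sum_inject prod_eq_iff)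

lemma linf_sum_components [simp]:
  "lfst (z + w) = lfst z + lfst w" "lsnd (z + w) = lsnd z + lsnd w"
  "lfst (z - w) = lfst z - lfst w" "lsnd (z - w) = lsnd z - lsnd w"
  "lfst (a *\<^sub>R z) = a *\<^sub>R lfst z" "lsnd (a *\<^sub>R z) = a *\<^sub>R lsnd z"
  "lfst (- z) = - lfst z" "lsnd (- z) = - lsnd z"
  "lfst 0 = 0" "lsnd 0 = 0"
  unfolding lfst_def lsnd_def
  by (simp_all add: plus_linf_sum.rep_eq minus_linf_sum.rep_eq scaleR_linf_sum.rep_eq
      uminus_linf_sum.rep_eq zero_linf_sum.rep_eq)

lemma norm_linf_sum_eq: "norm z = max (norm (lfst z)) (norm (lsnd z))"
  by (simp add: norm_linf_sum.rep_eq lfst_def lsnd_def)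

lemma dist_linf_sum_eq: "dist z w = max (dist (lfst z) (lfst w)) (dist (lsnd z) (lsnd w))"
  by (simp add: dist_norm norm_linf_sum_eq)

section \<open>Coordinates and norm of \<open>c0\<close>\<close>

lemma c0_nth_diff [simp]:
  "c0_nth (x - y) n = c0_nth x n - c0_nth y n"
  by (simp add: minus_c0.rep_eq)

lemma abs_c0_nth_le_norm: "\<bar>c0_nth x n\<bar> \<le> norm x"
  using SUP_abs_norm_facts(1)[OF bounded_c0_nth bounded_c0_nth] by (simp add: norm_c0.rep_eq)

lemma norm_c0_leI: "(\<And>n. \<bar>c0_nth x n\<bar> \<le> b) \<Longrightarrow> norm x \<le> b"
  by (simp add: norm_c0.rep_eq cSUP_least)

lemma c0_tendsto: "c0_nth x \<longlonglongrightarrow> 0"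
  using c0_nth[of x] by simp

text \<open>The tail stays below \<open>r / 2\<close>, so the supremum is bounded by a maximum of
  finitely many numbers, all less than \<open>r\<close>. For general bounded sequences the strict
  inequality would be lost.\<close>

lemma norm_c0_lessI:
  assumes r: "0 < r" and less: "\<And>n. \<bar>c0_nth x n\<bar> < r"
  shows "norm x < r"
proof -
  obtain N where N: "\<And>n. N \<le> n \<Longrightarrow> \<bar>c0_nth x n\<bar> < r / 2"
    using LIMSEQ_D[OF c0_tendsto, of "r / 2" x] r by auto
  define b where "b = Max (insert (r / 2) ((\<lambda>n. \<bar>c0_nth x n\<bar>) ` {..<N}))"
  have "norm x \<le> b"
  proof (rule norm_c0_leI)
    fix n
    show "\<bar>c0_nth x n\<bar> \<le> b"
    proof (cases "n < N")
      case True
      then show ?thesis unfolding b_def by (intro Max_ge) auto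
    next
      case False
      then have "\<bar>c0_nth x n\<bar> \<le> r / 2" using N[of n] by simp
      also have "\<dots> \<le> b" unfolding b_def by (intro Max_ge) auto
      finally show ?thesis .
    qed
  qed
  also have "b < r" unfolding b_def using r less by (subst Max_less_iff) auto
  finally show ?thesis .
qed

text \<open>Finitely supported rational sequences are dense; encoding them by lists of rationals
  makes countability immediate.\<close>

lemma c0_countable_dense:
  "\<exists>D :: c0 set. countable D \<and> (\<forall>x e. 0 < e \<longrightarrow> (\<exists>d\<in>D. dist d x < e))"
proof (intro exI conjI allI impI)
  define q where "q xs = Abs_c0 (\<lambda>n. if n < length xs then real_of_rat (xs ! n) else 0)" for xs
  have q: "c0_nth (q xs) n = (if n < length xs then real_of_rat (xs ! n) else 0)" for xs n
  proof -
    have "(\<lambda>n. if n < length xs then real_of_rat (xs ! n) else 0) \<longlonglongrightarrow> 0"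
      by (rule tendsto_eventually) (use eventually_ge_at_top[of "length xs"] in eventually_elim, simp)
    then show ?thesis by (simp add: q_def Abs_c0_inverse)
  qed
  show "countable (range q)" by simp
  fix x :: c0 and e :: real
  assume e: "0 < e"
  obtain N where N: "\<And>n. N \<le> n \<Longrightarrow> \<bar>c0_nth x n\<bar> < e"
    using LIMSEQ_D[OF c0_tendsto, of e x] e by auto
  have "\<exists>p. \<bar>real_of_rat p - c0_nth x n\<bar> < e" for n
  proof -
    obtain p where "c0_nth x n < real_of_rat p" "real_of_rat p < c0_nth x n + e"
      using of_rat_dense[of "c0_nth x n" "c0_nth x n + e"] e by auto
    then have "\<bar>real_of_rat p - c0_nth x n\<bar> < e" by (simp add: abs_if)
    then show ?thesis ..
  qed
  then obtain p where p: "\<And>n. \<bar>real_of_rat (p n) - c0_nth x n\<bar> < e" by metis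
  have "norm (q (map p [0..<N]) - x) < e"
    by (rule norm_c0_lessI[OF e]) (use p N in \<open>auto simp: q\<close>)
  then show "\<exists>d\<in>range q. dist d x < e" by (auto simp: dist_norm)
qed

text \<open>Each open ball contains a point of \<open>D\<close>, and disjointness makes the choice
  of such points injective.\<close>

lemma countable_non_overlapping_balls:
  fixes D :: "'a::real_normed_vector set" and c :: "'i \<Rightarrow> 'a"
  assumes D: "countable D" "\<And>x e. 0 < e \<Longrightarrow> \<exists>d\<in>D. dist d x < e"
    and r: "\<And>A. A \<in> F \<Longrightarrow> 0 < r A"
    and disj: "\<And>A B z. A \<in> F \<Longrightarrow> B \<in> F \<Longrightarrow> dist (c A) z < r A \<Longrightarrow> dist (c B) z < r B \<Longrightarrow> A = B"
  shows "countable F"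
proof -
  have "\<forall>A\<in>F. \<exists>d. d \<in> D \<and> dist (c A) d < r A"
    using D(2) r by (metis dist_commute)
  then obtain d where d: "\<And>A. A \<in> F \<Longrightarrow> d A \<in> D \<and> dist (c A) (d A) < r A"
    by metis
  have "inj_on d F"
  proof (rule inj_onI)
    fix A B assume AB: "A \<in> F" "B \<in> F" "d A = d B"
    then have "dist (c B) (d A) < r B" using d[of B] by simp
    with AB show "A = B" using disj[of A B "d A"] d[of A] by blast
  qed
  moreover have "countable (d ` F)"
    by (rule countable_subset[OF _ D(1)]) (use d in auto)
  ultimately show ?thesis using countable_image_inj_on by blast
qed

text \<open>A ball of the max norm meets a level \<open>lsnd z = v\<close> either in a copy of a
  ball of X with the same radius or not at all.\<close>

lemma tiling_by_balls_slice:
  fixes F :: "('a::real_normed_vector \<oplus>\<^sub>\<infinity> c0) set set"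
  assumes separable: "separable_space (euclidean :: 'a topology)"
    and F: "tiling_by_balls F"
  shows "\<exists>G :: 'a set set. tiling_by_balls G"
proof -
  obtain c :: "('a \<oplus>\<^sub>\<infinity> c0) set \<Rightarrow> ('a \<oplus>\<^sub>\<infinity> c0)" and r where cr: "\<forall>A\<in>F. 0 < r A" "\<forall>z. \<exists>A\<in>F. dist (c A) z \<le> r A"
    "\<forall>A\<in>F. \<forall>B\<in>F. \<forall>z. dist (c A) z < r A \<longrightarrow> dist (c B) z < r B \<longrightarrow> A = B"
    using tiling_by_balls_centers[OF F] by (elim exE conjE)
  have r: "0 < r A" if "A \<in> F" for A using cr(1) that by blast
  have cover: "\<exists>A\<in>F. dist (c A) z \<le> r A" for z using cr(2) by blast
  have disj: "A = B" if "A \<in> F" "B \<in> F" "dist (c A) z < r A" "dist (c B) z < r B" for A B z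
    using cr(3) that by blast
  obtain D :: "'a set" where D: "countable D" "closure D = UNIV"
    using separable by (auto simp: separable_space_def)
  obtain E :: "c0 set" where E: "countable E" "\<And>x e. 0 < e \<Longrightarrow> \<exists>d\<in>E. dist d x < e"
    using c0_countable_dense by blast
  have "countable F"
  proof (rule countable_non_overlapping_balls[OF _ _ r disj])
    show "countable ((\<lambda>(x, v). linf_pair x v) ` (D \<times> E))"
      using D E by simp
    fix z :: "'a \<oplus>\<^sub>\<infinity> c0" and e :: real
    assume e: "0 < e"
    obtain x where "x \<in> D" "dist x (lfst z) < e"
      using D(2) e closure_approachable by blast
    moreover obtain v where "v \<in> E" "dist v (lsnd z) < e"
      using E(2) e by blast
    ultimately show "\<exists>d\<in>(\<lambda>(x, v). linf_pair x v) ` (D \<times> E). dist d z < e"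
      by (force simp: dist_linf_sum_eq)
  qed auto
  \<comment> \<open>The level \<open>v\<close> avoids all spheres in \<open>c\<^sub>0\<close>: norms in \<open>c\<^sub>0\<close> are attained by a coordinate, so it
    suffices that every coordinate avoids countably many values.\<close>
  then have "\<exists>t\<in>{0<..<1 / real (Suc n)}.
      t \<notin> (\<Union>A\<in>F. {c0_nth (lsnd (c A)) n - r A, c0_nth (lsnd (c A)) n + r A})" for n
    by (intro real_interval_avoid_countable_set) auto
  then obtain t where t: "\<And>n. 0 < t n \<and> t n < 1 / real (Suc n)"
    and avoid: "\<And>n A. A \<in> F \<Longrightarrow> t n \<noteq> c0_nth (lsnd (c A)) n - r A \<and> t n \<noteq> c0_nth (lsnd (c A)) n + r A"
    by (simp add: Bex_def) metis
  have "t \<longlonglongrightarrow> 0"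
    by (rule tendsto_sandwich[OF _ _ tendsto_const LIMSEQ_inverse_real_of_nat])
      (use t in \<open>auto intro!: always_eventually less_imp_le simp: inverse_eq_divide\<close>)
  then obtain v where v: "c0_nth v = t"
    by (metis Abs_c0_inverse mem_Collect_eq)
  \<comment> \<open>Every tile reaching the level passes strictly through it. Hence overlapping
    slices come from overlapping tiles, not from tiles that merely touch at the level.\<close>
  have strict: "dist (lsnd (c A)) v < r A" if "A \<in> F" "dist (lsnd (c A)) v \<le> r A" for A
    unfolding dist_norm
  proof (rule norm_c0_lessI[OF r[OF that(1)]])
    fix n
    have "\<bar>c0_nth (lsnd (c A) - v) n\<bar> \<le> r A"
      using abs_c0_nth_le_norm[of "lsnd (c A) - v" n] that(2) unfolding dist_norm by linarith
    then show "\<bar>c0_nth (lsnd (c A) - v) n\<bar> < r A"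
      using avoid[OF that(1), of n] by (auto simp: v abs_if split: if_splits)
  qed
  define H where "H = {A \<in> F. dist (lsnd (c A)) v \<le> r A}"
  have "tiling_by_balls ((\<lambda>A. cball (lfst (c A)) (r A)) ` H)"
  proof (rule tiling_by_balls_parametrized)
    show "0 < r A" if "A \<in> H" for A using that r by (simp add: H_def)
    show "\<exists>A\<in>H. dist (lfst (c A)) x \<le> r A" for x
      using cover[of "linf_pair x v"] by (auto simp: H_def dist_linf_sum_eq)
    show "cball (lfst (c A)) (r A) = cball (lfst (c B)) (r B)"
      if "A \<in> H" "B \<in> H" "dist (lfst (c A)) x < r A" "dist (lfst (c B)) x < r B" for A B x
      using disj[of A B "linf_pair x v"] that strict by (auto simp: H_def dist_linf_sum_eq)
  qed
  then show ?thesis by blast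
qed

text \<open>Rounding to the nearest multiple of \<open>2 * r\<close> moves a coordinate by at most
  \<open>r\<close> and sends coordinates smaller than \<open>r\<close> to 0, so the rounded sequence
  is again null.\<close>

lemma c0_round:
  assumes r: "0 < r"
  obtains g where "\<And>n. c0_nth g n = 2 * r * of_int (round (c0_nth w n / (2 * r)))"
    "dist g w \<le> r"
proof -
  define f where "f n = 2 * r * real_of_int (round (c0_nth w n / (2 * r)))" for n
  obtain N where N: "\<And>n. N \<le> n \<Longrightarrow> \<bar>c0_nth w n\<bar> < r"
    using LIMSEQ_D[OF c0_tendsto, of r w] r by auto
  have "f n = 0" if "N \<le> n" for n
  proof -
    have "round (c0_nth w n / (2 * r)) = 0"
      by (rule round_unique') (use N[OF that] r in \<open>simp add: field_simps abs_if split: if_splits\<close>)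
    then show ?thesis by (simp add: f_def)
  qed
  then have "f \<longlonglongrightarrow> 0"
    by (intro tendsto_eventually) (auto simp: eventually_sequentially)
  then obtain g where g: "c0_nth g = f"
    by (metis Abs_c0_inverse mem_Collect_eq)
  have "norm (g - w) \<le> r"
  proof (rule norm_c0_leI)
    fix n
    define s where "s = c0_nth w n / (2 * r)"
    have "c0_nth w n = 2 * r * s" using r by (simp add: s_def)
    then have "\<bar>c0_nth (g - w) n\<bar> = 2 * r * \<bar>of_int (round s) - s\<bar>"
      using r by (simp add: g f_def flip: s_def right_diff_distrib) (simp add: abs_mult)
    also have "\<dots> \<le> 2 * r * (1 / 2)"
      by (intro mult_left_mono of_int_round_abs_le) (use r in auto)
    finally show "\<bar>c0_nth (g - w) n\<bar> \<le> r" by simp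
  qed
  then show ?thesis using that[of g] g by (simp add: f_def dist_norm)
qed

text \<open>Giving the cubes over a tile \<open>A\<close> the radius \<open>r A\<close> makes each
  product a ball of the max norm.\<close>

lemma tiling_by_balls_product_c0:
  fixes F :: "'a::real_normed_vector set set"
  assumes F: "tiling_by_balls F"
  shows "\<exists>G :: ('a \<oplus>\<^sub>\<infinity> c0) set set. tiling_by_balls G"
proof -
  obtain c :: "'a set \<Rightarrow> 'a" and r where cr: "\<forall>A\<in>F. 0 < r A" "\<forall>z. \<exists>A\<in>F. dist (c A) z \<le> r A"
    "\<forall>A\<in>F. \<forall>B\<in>F. \<forall>z. dist (c A) z < r A \<longrightarrow> dist (c B) z < r B \<longrightarrow> A = B"
    using tiling_by_balls_centers[OF F] by (elim exE conjE)
  have r: "0 < r A" if "A \<in> F" for A using cr(1) that by blast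
  have cover: "\<exists>A\<in>F. dist (c A) z \<le> r A" for z using cr(2) by blast
  have disj: "A = B" if "A \<in> F" "B \<in> F" "dist (c A) z < r A" "dist (c B) z < r B" for A B z
    using cr(3) that by blast
  define grid where "grid \<rho> = {g. \<forall>n. \<exists>m::int. c0_nth g n = 2 * \<rho> * m}" for \<rho>
  define I where "I = Sigma F (\<lambda>A. grid (r A))"
  define z :: "'a set \<times> c0 \<Rightarrow> ('a \<oplus>\<^sub>\<infinity> c0)" where "z = (\<lambda>(A, g). linf_pair (c A) g)"
  have "tiling_by_balls ((\<lambda>i. cball (z i) (r (fst i))) ` I)"
  proof (rule tiling_by_balls_parametrized)
    show "0 < r (fst i)" if "i \<in> I" for i
      using that r by (auto simp: I_def)
    show "\<exists>i\<in>I. dist (z i) p \<le> r (fst i)" for p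
    proof -
      obtain A where A: "A \<in> F" "dist (c A) (lfst p) \<le> r A"
        using cover by blast
      obtain g where g: "\<And>n. c0_nth g n = 2 * r A * of_int (round (c0_nth (lsnd p) n / (2 * r A)))"
        and dist: "dist g (lsnd p) \<le> r A"
        using c0_round[OF r[OF A(1)]] by metis
      have "g \<in> grid (r A)" using g by (auto simp: grid_def)
      then have "(A, g) \<in> I" using A by (simp add: I_def)
      moreover have "dist (z (A, g)) p \<le> r (fst (A, g))"
        using A dist by (simp add: z_def dist_linf_sum_eq)
      ultimately show ?thesis by blast
    qed
    show "cball (z i) (r (fst i)) = cball (z j) (r (fst j))"
      if ij: "i \<in> I" "j \<in> I" and less: "dist (z i) p < r (fst i)" "dist (z j) p < r (fst j)" for i j p
    proof -
      obtain A g B h where eq: "i = (A, g)" "j = (B, h)" by (metis prod.exhaust)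
      have AB: "A \<in> F" "B \<in> F" and grid: "g \<in> grid (r A)" "h \<in> grid (r B)"
        using ij by (auto simp: I_def eq)
      \<comment> \<open>The X-components settle the tile first; only then do both grid points belong
        to the same grid.\<close>
      have "A = B"
        using disj[OF AB, of "lfst p"] less by (simp add: eq z_def dist_linf_sum_eq)
      moreover have "c0_nth g n = c0_nth h n" for n
      proof -
        obtain k m :: int where km: "c0_nth g n = 2 * r A * k" "c0_nth h n = 2 * r A * m"
          using grid \<open>A = B\<close> by (force simp: grid_def)
        \<comment> \<open>Both grid coordinates lie within \<open>r A\<close> of the same number, so
          the integers \<open>k\<close> and \<open>m\<close> differ by less than 1.\<close>
        have "\<bar>c0_nth (g - lsnd p) n\<bar> < r A" "\<bar>c0_nth (h - lsnd p) n\<bar> < r A"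
          using less abs_c0_nth_le_norm \<open>A = B\<close>
          by (auto intro: le_less_trans simp: eq z_def dist_linf_sum_eq dist_norm simp del: c0_nth_diff)
        then have "\<bar>2 * r A * k - 2 * r A * m\<bar> < 2 * r A"
          unfolding c0_nth_diff km by linarith
        also have "2 * r A * k - 2 * r A * m = 2 * r A * of_int (k - m)"
          by (simp add: algebra_simps)
        finally have "\<bar>real_of_int (k - m)\<bar> < 1"
          using r[OF AB(1)] by (simp add: abs_mult)
        then have "k = m" by linarith
        then show ?thesis by (simp add: km)
      qed
      then have "g = h" by (auto simp flip: c0_nth_inject)
      ultimately show ?thesis by (simp add: eq)
    qed
  qed
  then show ?thesis by blast
qed

section \<open>Tilings of \<open>X \<oplus>\<^sub>\<infinity> c\<^sub>0\<^sub>0\<close>\<close>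

lemma c00_nth_components [simp]:
  "c00_nth (x + y) n = c00_nth x n + c00_nth y n" "c00_nth (x - y) n = c00_nth x n - c00_nth y n"
  "c00_nth (a *\<^sub>R x) n = a * c00_nth x n" "c00_nth 0 n = 0"
  by (simp_all add: plus_c00.rep_eq minus_c00.rep_eq scaleR_c00.rep_eq zero_c00.rep_eq)

lemma abs_c00_nth_le_norm: "\<bar>c00_nth x n\<bar> \<le> norm x"
  using SUP_abs_norm_facts(1)[OF bounded_c00_nth bounded_c00_nth] by (simp add: norm_c00.rep_eq)

lemma norm_c00_leI: "(\<And>n. \<bar>c00_nth x n\<bar> \<le> b) \<Longrightarrow> norm x \<le> b"
  by (simp add: norm_c00.rep_eq cSUP_least)

lemma c00_nth_Abs:
  assumes "\<And>k. N \<le> k \<Longrightarrow> f k = 0"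
  shows "c00_nth (Abs_c00 f) = f"
proof -
  have "{k. f k \<noteq> 0} \<subseteq> {..<N}" using assms by (force simp: not_le[symmetric])
  then have "finite {k. f k \<noteq> 0}" by (rule finite_subset) simp
  then show ?thesis by (simp add: Abs_c00_inverse)
qed

lemma c00_nth_eventually_zero: "\<exists>N. \<forall>k\<ge>N. c00_nth x k = 0"
proof -
  have "finite {k. c00_nth x k \<noteq> 0}" using c00_nth[of x] by simp
  then obtain N where "\<And>k. c00_nth x k \<noteq> 0 \<Longrightarrow> k < N"
    by (auto simp: finite_nat_set_iff_bounded)
  then show ?thesis by (metis not_le)
qed

definition c00_unit :: "nat \<Rightarrow> c00"
  where "c00_unit n = Abs_c00 (\<lambda>k. if k = n then 1 else 0)"

lemma c00_nth_unit [simp]: "c00_nth (c00_unit n) k = (if k = n then 1 else 0)"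
  unfolding c00_unit_def by (subst c00_nth_Abs[of "Suc n"]) auto

text \<open>Induction on a bound \<open>N\<close> for the support, removing the last coordinate with
  a multiple of \<open>c00_unit N\<close>.\<close>

lemma span_c00_units: "span (range c00_unit) = UNIV"
proof -
  have "x \<in> span (range c00_unit)" if "\<forall>k\<ge>N. c00_nth x k = 0" for x N
    using that
  proof (induction N arbitrary: x)
    case 0
    then have "x = 0" by (auto simp flip: c00_nth_inject)
    then show ?case by (simp add: span_zero)
  next
    case (Suc N)
    define y where "y = x - c00_nth x N *\<^sub>R c00_unit N"
    have "y \<in> span (range c00_unit)"
    proof (intro Suc.IH allI impI)
      fix k assume "N \<le> k"
      then show "c00_nth y k = 0"
        using Suc.prems by (cases "k = N") (auto simp: y_def)
    qed
    moreover have "c00_nth x N *\<^sub>R c00_unit N \<in> span (range c00_unit)"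
      by (intro span_scale span_base) simp
    ultimately have "y + c00_nth x N *\<^sub>R c00_unit N \<in> span (range c00_unit)"
      by (rule span_add)
    then show ?case by (simp add: y_def)
  qed
  then show ?thesis using c00_nth_eventually_zero by blast
qed

lemma span_linf_sum:
  fixes S :: "'a::real_vector set" and T :: "'b::real_vector set"
  assumes S: "span S = UNIV" and T: "span T = UNIV"
  shows "span ((\<lambda>x. linf_pair x 0) ` S \<union> linf_pair 0 ` T) = (UNIV :: ('a \<oplus>\<^sub>\<infinity> 'b) set)"
    (is "span ?U = _")
proof -
  have "linear (\<lambda>x. linf_pair x 0 :: 'a \<oplus>\<^sub>\<infinity> 'b)" "linear (linf_pair 0 :: 'b \<Rightarrow> ('a \<oplus>\<^sub>\<infinity> 'b))"
    by (auto intro!: linearI simp: linf_sum_eq_iff)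
  then have "span ((\<lambda>x. linf_pair x 0 :: 'a \<oplus>\<^sub>\<infinity> 'b) ` S) = range (\<lambda>x. linf_pair x 0)"
    "span ((linf_pair 0 :: 'b \<Rightarrow> ('a \<oplus>\<^sub>\<infinity> 'b)) ` T) = range (linf_pair 0)"
    using S T by (simp_all add: linear_span_image)
  then have "linf_pair x 0 \<in> span ?U" "linf_pair 0 v \<in> span ?U" for x v
    by (metis Un_upper1 Un_upper2 rangeI span_mono subsetD)+
  then have "linf_pair (lfst z) 0 + linf_pair 0 (lsnd z) \<in> span ?U" for z
    by (rule span_add)
  moreover have "linf_pair (lfst z) 0 + linf_pair 0 (lsnd z) = z" for z :: "'a \<oplus>\<^sub>\<infinity> 'b"
    by (simp add: linf_sum_eq_iff)
  ultimately show ?thesis by (metis UNIV_eq_I)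
qed

section \<open>Exhaustion by compact subsets of finite-dimensional subspaces\<close>

text \<open>The linear combinations of the list with coefficients in \<open>{-b..b}\<close>, built
  as a sum of segments so that compactness follows by induction.\<close>

fun coeff_box :: "'a::real_vector list \<Rightarrow> real \<Rightarrow> 'a set"
  where "coeff_box [] b = {0}"
  | "coeff_box (x # xs) b = {y + z | y z. y \<in> (\<lambda>a. a *\<^sub>R x) ` {-b..b} \<and> z \<in> coeff_box xs b}"

lemma compact_coeff_box: "compact (coeff_box xs b)" for xs :: "'a::real_normed_vector list"
proof (induction xs)
  case (Cons x xs)
  have "compact ((\<lambda>a. a *\<^sub>R x) ` {-b..b})"
    by (intro compact_continuous_image continuous_intros) auto
  then show ?case using Cons.IH by (simp only: coeff_box.simps) (rule compact_sums)
qed simp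

lemma coeff_box_mono:
  assumes "b \<le> b'"
  shows "coeff_box xs b \<subseteq> coeff_box xs b'"
proof (induction xs)
  case (Cons x xs)
  have "(\<lambda>a. a *\<^sub>R x) ` {-b..b} \<subseteq> (\<lambda>a. a *\<^sub>R x) ` {-b'..b'}"
    using assms by (intro image_mono) auto
  then show ?case using Cons.IH unfolding coeff_box.simps by blast
qed simp

lemma coeff_box_subset_span: "coeff_box xs b \<subseteq> span (set xs)"
proof (induction xs)
  case (Cons x xs)
  then have "coeff_box xs b \<subseteq> span (set (x # xs))"
    using span_mono[of "set xs" "set (x # xs)"] by auto
  then show ?case by (force intro!: span_add span_scale intro: span_base)
qed simp

text \<open>Lists may repeat vectors, so adding a term just prepends its vector; enlarging the bound
  to \<open>max m k\<close> accommodates the new coefficient.\<close>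

lemma span_subset_coeff_boxes:
  assumes "z \<in> span S"
  shows "\<exists>xs\<in>lists S. \<exists>m::nat. z \<in> coeff_box xs (real m)"
  using assms
proof (induction rule: span_induct_alt)
  case base
  then show ?case by (intro bexI[of _ "[]"]) auto
next
  case (step c x y)
  then obtain xs m where xs: "xs \<in> lists S" "y \<in> coeff_box xs (real m)" by blast
  obtain k :: nat where k: "\<bar>c\<bar> \<le> real k" using real_arch_simple by blast
  have "c \<in> {- real (max m k)..real (max m k)}" using k by auto
  moreover have "y \<in> coeff_box xs (real (max m k))"
    using xs coeff_box_mono[of "real m" "real (max m k)" xs] by auto
  ultimately have "c *\<^sub>R x + y \<in> coeff_box (x # xs) (real (max m k))"
    unfolding coeff_box.simps by blast
  then show ?case using xs step.hyps by (intro bexI[of _ "x # xs"]) auto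
qed

text \<open>There are only countably many pairs of a list over \<open>S\<close> and an integer
  bound. The finite \<open>T\<close> later bounds the \<open>c00\<close> coordinates occurring in
  \<open>K n\<close>.\<close>

lemma countable_span_compact_cover:
  fixes S :: "'a::real_normed_vector set"
  assumes S: "countable S" "span S = UNIV"
  shows "\<exists>K :: nat \<Rightarrow> 'a set. (\<Union>n. K n) = UNIV \<and>
    (\<forall>n. compact (K n) \<and> (\<exists>T. finite T \<and> T \<subseteq> S \<and> K n \<subseteq> span T))"
proof -
  define I where "I = lists S \<times> (UNIV :: nat set)"
  define K where "K n = (\<lambda>(xs, m). coeff_box xs (real m)) (from_nat_into I n)" for n
  have I: "countable I" "I \<noteq> {}"
    using S by (auto simp: I_def)
  have "\<exists>n. z \<in> K n" for z
  proof -
    obtain xs m where xs: "xs \<in> lists S" "z \<in> coeff_box xs (real (m :: nat))"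
      using span_subset_coeff_boxes[of z S] S(2) by blast
    then have "(xs, m) \<in> range (from_nat_into I)"
      using range_from_nat_into[OF I(2,1)] by (simp add: I_def)
    then obtain n where "from_nat_into I n = (xs, m)" by (metis rangeE)
    then have "z \<in> K n" using xs(2) by (simp add: K_def)
    then show ?thesis ..
  qed
  then have "(\<Union>n. K n) = UNIV" by blast
  moreover have "compact (K n) \<and> (\<exists>T. finite T \<and> T \<subseteq> S \<and> K n \<subseteq> span T)" for n
  proof -
    obtain xs m where xs: "from_nat_into I n = (xs, m)" by (metis prod.exhaust)
    then have "set xs \<subseteq> S"
      using from_nat_into[OF I(2), of n] by (auto simp: I_def)
    then show ?thesis
      using compact_coeff_box[of xs "real m"] coeff_box_subset_span[of xs "real m"]
      by (auto simp: K_def xs intro!: exI[of _ "set xs"])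
  qed
  ultimately show ?thesis by blast
qed

section \<open>One stage of the star-finite construction\<close>

text \<open>For \<open>C = {}\<close>, which is where the construction starts,
  \<open>infdist\<close> is constantly 0 and positivity would fail; the constant 1 takes its
  place.\<close>

lemma exists_distance_function:
  fixes C :: "'a::metric_space set"
  assumes "closed C"
  shows "\<exists>\<delta> :: 'a \<Rightarrow> real. (\<forall>x y. \<delta> x \<le> \<delta> y + dist x y) \<and> (\<forall>x. 0 < \<delta> x \<longleftrightarrow> x \<notin> C) \<and>
    (\<forall>x. \<forall>y\<in>C. \<delta> x \<le> dist x y)"
proof (cases "C = {}")
  case True
  then show ?thesis by (intro exI[of _ "\<lambda>_. 1"]) simp
next
  case False
  then show ?thesis
    using assms infdist_triangle infdist_pos_not_in_closed[OF assms False] infdist_le[of _ C]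
    by (intro exI[of _ "\<lambda>x. infdist x C"]) (auto simp: order.strict_iff_not)
qed

text \<open>The part of \<open>K\<close> where \<open>\<delta>\<close> is positive need not be
  compact, but it splits into compact layers according to the size of \<open>\<delta>\<close>. Each
  layer needs finitely many balls, and the condition \<open>\<eta> \<le> \<delta> p\<close> leaves
  only the layers with \<open>n \<le> 1 / \<eta>\<close>.\<close>

lemma compact_discrete_net:
  fixes K :: "'a::metric_space set" and \<delta> :: "'a \<Rightarrow> real"
  assumes K: "compact K" and \<delta>: "continuous_on UNIV \<delta>"
  shows "\<exists>P\<subseteq>K. (\<forall>p\<in>P. 0 < \<delta> p) \<and> (\<forall>z\<in>K. 0 < \<delta> z \<longrightarrow> (\<exists>p\<in>P. dist p z < \<delta> p / 3)) \<and>
    (\<forall>\<eta>>0. finite {p\<in>P. \<eta> \<le> \<delta> p})"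
proof -
  \<comment> \<open>The bound \<open>\<delta> z \<le> 1 / n\<close> is written as a product so that
    it is void for \<open>n = 0\<close>.\<close>
  define L where "L n = K \<inter> {z. 1 / real (Suc n) \<le> \<delta> z \<and> real n * \<delta> z \<le> 1}" for n
  have pos: "0 < \<delta> p" if "p \<in> L n" for p n
  proof -
    have "0 < 1 / real (Suc n)" by simp
    also have "\<dots> \<le> \<delta> p" using that by (simp add: L_def)
    finally show ?thesis .
  qed
  have "\<exists>Q\<subseteq>L n. finite Q \<and> L n \<subseteq> (\<Union>p\<in>Q. ball p (\<delta> p / 3))" for n
  proof -
    have "compact (L n)"
      unfolding L_def by (intro compact_Int_closed K closed_Collect_conj closed_Collect_le continuous_intros \<delta>)
    then show ?thesis
    proof (rule compactE_image)
      show "L n \<subseteq> (\<Union>p\<in>L n. ball p (\<delta> p / 3))" using pos by force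
    next
      fix Q assume "Q \<subseteq> L n" "finite Q" "L n \<subseteq> (\<Union>p\<in>Q. ball p (\<delta> p / 3))"
      then show ?thesis by blast
    qed simp
  qed
  then obtain Q where Q: "\<And>n. Q n \<subseteq> L n" "\<And>n. finite (Q n)" "\<And>n. L n \<subseteq> (\<Union>p\<in>Q n. ball p (\<delta> p / 3))"
    by metis
  define P where "P = (\<Union>n. Q n)"
  have "P \<subseteq> K" using Q(1) by (auto simp: P_def L_def)
  moreover have "\<forall>p\<in>P. 0 < \<delta> p" using Q(1) pos by (auto simp: P_def)
  moreover have "\<exists>p\<in>P. dist p z < \<delta> p / 3" if z: "z \<in> K" "0 < \<delta> z" for z
  proof -
    define n where "n = nat \<lfloor>1 / \<delta> z\<rfloor>"
    have "real n \<le> 1 / \<delta> z" "1 / \<delta> z \<le> real (Suc n)"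
      using z by (auto simp: n_def) linarith
    then have "z \<in> L n" using z by (auto simp: L_def field_simps)
    then obtain p where "p \<in> Q n" "z \<in> ball p (\<delta> p / 3)" using Q(3) by blast
    then show ?thesis by (auto simp: P_def)
  qed
  moreover have "finite {p\<in>P. \<eta> \<le> \<delta> p}" if "0 < \<eta>" for \<eta>
  proof -
    obtain N :: nat where N: "1 / \<eta> \<le> real N" using real_arch_simple by blast
    have "{p\<in>P. \<eta> \<le> \<delta> p} \<subseteq> (\<Union>n\<le>N. Q n)"
    proof
      fix p assume "p \<in> {p\<in>P. \<eta> \<le> \<delta> p}"
      then obtain n where n: "p \<in> Q n" "\<eta> \<le> \<delta> p" by (auto simp: P_def)
      then have "real n * \<delta> p \<le> 1" using Q(1) by (auto simp: L_def)
      moreover have "real n * \<eta> \<le> real n * \<delta> p" using n(2) by (simp add: mult_left_mono)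
      ultimately have "real n \<le> 1 / \<eta>" using that by (simp add: field_simps)
      then show "p \<in> (\<Union>n\<le>N. Q n)" using N n(1) by auto
    qed
    then show ?thesis by (rule finite_subset) (use Q(2) in simp)
  qed
  ultimately show ?thesis by blast
qed

text \<open>
  For \<open>i < j\<close>, \<open>separator N i\<close> and \<open>separator N j\<close> have opposite signs in coordinate \<open>N + i\<close>, so
  cubes with centers \<open>r *\<^sub>R separator N i\<close>, \<open>s *\<^sub>R separator N j\<close> and radii \<open>r\<close>, \<open>s\<close> do not overlap,
  although both contain \<open>0\<close>.
\<close>
definition separator :: "nat \<Rightarrow> nat \<Rightarrow> c00"
  where "separator N i =
    Abs_c00 (\<lambda>k. if k < N then 0 else if k < N + i then - 1 else if k = N + i then 1 else 0)"

lemma c00_nth_separator: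
  "c00_nth (separator N i) k = (if k < N then 0 else if k < N + i then - 1 else if k = N + i then 1 else 0)"
  unfolding separator_def by (subst c00_nth_Abs[of "Suc (N + i)"]) auto

lemma norm_separator_le: "norm (separator N i) \<le> 1"
  by (rule norm_c00_leI) (simp add: c00_nth_separator)

text \<open>The new tiles are disjoint from \<open>C\<close>, not merely non-overlapping with it, so
  that a later stage adds no neighbours to earlier tiles.\<close>

lemma star_finite_stage:
  fixes C K :: "('a::real_normed_vector \<oplus>\<^sub>\<infinity> c00) set"
  assumes C: "closed C" and K: "compact K"
    and N: "\<And>z k. z \<in> K \<Longrightarrow> N \<le> k \<Longrightarrow> c00_nth (lsnd z) k = 0"
  shows "\<exists>G. (\<forall>A\<in>G. is_ball A \<and> A \<inter> C = {}) \<and> non_overlapping G \<and> star_finite G \<and>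
    closed (C \<union> \<Union>G) \<and> K \<subseteq> C \<union> \<Union>G"
proof -
  obtain \<delta> :: "('a \<oplus>\<^sub>\<infinity> c00) \<Rightarrow> real" where lip: "\<And>x y. \<delta> x \<le> \<delta> y + dist x y"
    and pos: "\<And>x. 0 < \<delta> x \<longleftrightarrow> x \<notin> C" and far: "\<And>x y. y \<in> C \<Longrightarrow> \<delta> x \<le> dist x y"
    using exists_distance_function[OF C] by metis
  have "continuous_on UNIV \<delta>"
  proof (rule continuous_on_iff[THEN iffD2], intro ballI allI impI exI conjI)
    fix x y :: "'a \<oplus>\<^sub>\<infinity> c00" and e :: real
    assume "dist y x < e"
    then show "dist (\<delta> y) (\<delta> x) < e"
      using lip[of x y] lip[of y x] by (simp add: dist_real_def dist_commute abs_if)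
  qed
  from compact_discrete_net[OF K this] obtain P where "P \<subseteq> K" "\<forall>p\<in>P. 0 < \<delta> p"
    "\<forall>z\<in>K. 0 < \<delta> z \<longrightarrow> (\<exists>p\<in>P. dist p z < \<delta> p / 3)" "\<forall>\<eta>>0. finite {p\<in>P. \<eta> \<le> \<delta> p}"
    by (elim exE conjE)
  then have P: "P \<subseteq> K" "\<And>p. p \<in> P \<Longrightarrow> 0 < \<delta> p"
    and net: "\<And>z. z \<in> K \<Longrightarrow> 0 < \<delta> z \<Longrightarrow> \<exists>p\<in>P. dist p z < \<delta> p / 3"
    and fin: "\<And>\<eta>. 0 < \<eta> \<Longrightarrow> finite {p\<in>P. \<eta> \<le> \<delta> p}"
    by blast+
  have "P \<subseteq> (\<Union>n. {p\<in>P. 1 / real (Suc n) \<le> \<delta> p})"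
  proof
    fix p assume "p \<in> P"
    moreover obtain n where "inverse (real (Suc n)) < \<delta> p"
      using P(2)[OF \<open>p \<in> P\<close>] reals_Archimedean by blast
    ultimately show "p \<in> (\<Union>n. {p\<in>P. 1 / real (Suc n) \<le> \<delta> p})"
      by (auto simp: inverse_eq_divide intro!: exI[of _ n])
  qed
  moreover have "countable (\<Union>n. {p\<in>P. 1 / real (Suc n) \<le> \<delta> p})"
    by (intro countable_UN countableI_type countable_finite fin) simp
  ultimately have "countable P" by (rule countable_subset)
  then have inj: "inj_on (to_nat_on P) P" by (rule inj_on_to_nat_on)
  define r where "r p = \<delta> p / 3" for p
  define s where "s p = separator N (to_nat_on P p)" for p
  \<comment> \<open>The shift changes only coordinates from \<open>N\<close> on, where
    \<open>K\<close> vanishes, and by at most \<open>r p\<close>. Shift and radius together stay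
    within two thirds of \<open>\<delta> p\<close>, short of \<open>C\<close>.\<close>
  define c where "c p = p + r p *\<^sub>R linf_pair 0 (s p)" for p
  define T where "T p = cball (c p) (r p)" for p
  have r: "0 < r p" if "p \<in> P" for p using P(2)[OF that] by (simp add: r_def)
  have near: "dist p x \<le> 2 / 3 * \<delta> p" if "p \<in> P" "x \<in> T p" for p x
  proof -
    have "r p * norm (s p) \<le> r p * 1"
      using r[OF that(1)] norm_separator_le by (intro mult_left_mono) (auto simp: s_def)
    then have "dist p (c p) \<le> r p"
      using r[OF that(1)] by (simp add: dist_norm c_def norm_linf_sum_eq)
    moreover have "dist (c p) x \<le> r p" using that by (simp add: T_def)
    ultimately show ?thesis using dist_triangle[of p x "c p"] by (simp add: r_def)
  qed
  have away: "T p \<inter> C = {}" if "p \<in> P" for p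
  proof (rule ccontr)
    assume "T p \<inter> C \<noteq> {}"
    then obtain x where x: "x \<in> T p" "x \<in> C" by blast
    show False using near[OF that x(1)] far[OF x(2), of p] P(2)[OF that] by linarith
  qed
  \<comment> \<open>Combining \<open>near\<close> for both tiles with \<open>lip\<close> gives
    \<open>\<delta> p \<le> 2/3 * \<delta> p + 5/3 * \<delta> q\<close>, whence the factor
    5.\<close>
  have comparable: "\<delta> p / 5 \<le> \<delta> q" if pq: "p \<in> P" "q \<in> P" "T p \<inter> T q \<noteq> {}" for p q
  proof -
    obtain x where x: "x \<in> T p" "x \<in> T q" using pq(3) by blast
    have "dist p q \<le> 2 / 3 * \<delta> p + 2 / 3 * \<delta> q"
      using near[OF pq(1) x(1)] near[OF pq(2) x(2)] dist_triangle2[of p q x] by linarith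
    then show ?thesis using lip[of p q] by simp
  qed
  have separated: "False"
    if pq: "p \<in> P" "q \<in> P" "to_nat_on P p < to_nat_on P q"
      and x: "dist (c p) x < r p" "dist (c q) x < r q" for p q x
  proof -
    \<comment> \<open>In this coordinate the separator of \<open>p\<close> is 1 and that of
      \<open>q\<close> is -1, so the centers are at least \<open>r p + r q\<close> apart.\<close>
    define k where "k = N + to_nat_on P p"
    have "p \<in> K" "q \<in> K" using pq P(1) by auto
    then have k: "c00_nth (lsnd (c p)) k = r p" "c00_nth (lsnd (c q)) k = - r q"
      using pq(3) by (simp_all add: c_def s_def k_def c00_nth_separator N)
    have "\<bar>c00_nth (lsnd (c p)) k - c00_nth (lsnd x) k\<bar> < r p"
      using x(1) abs_c00_nth_le_norm[of "lsnd (c p) - lsnd x" k] by (auto simp: dist_linf_sum_eq dist_norm)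
    moreover have "\<bar>c00_nth (lsnd (c q)) k - c00_nth (lsnd x) k\<bar> < r q"
      using x(2) abs_c00_nth_le_norm[of "lsnd (c q) - lsnd x" k] by (auto simp: dist_linf_sum_eq dist_norm)
    ultimately show False unfolding k by linarith
  qed
  have "is_ball (T p)" if "p \<in> P" for p
    using r[OF that] by (auto simp: is_ball_def T_def)
  moreover have "non_overlapping (T ` P)"
  proof -
    have "disjnt (interior (T p)) (interior (T q))" if pq: "p \<in> P" "q \<in> P" "T p \<noteq> T q" for p q
    proof -
      have "to_nat_on P p \<noteq> to_nat_on P q" using pq inj by (auto dest: inj_onD)
      then show ?thesis
        using separated pq r by (auto simp: disjnt_iff T_def interior_cball_normed neq_iff)
    qed
    then show ?thesis by (auto simp: non_overlapping_def pairwise_def)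
  qed
  moreover have "star_finite (T ` P)"
    unfolding star_finite_def
  proof
    fix A assume "A \<in> T ` P"
    then obtain p where p: "p \<in> P" "A = T p" by blast
    have "{B \<in> T ` P. A \<inter> B \<noteq> {}} \<subseteq> T ` {q\<in>P. \<delta> p / 5 \<le> \<delta> q}"
      using comparable p by blast
    moreover have "finite (T ` {q\<in>P. \<delta> p / 5 \<le> \<delta> q})"
      by (intro finite_imageI fin) (use P(2)[OF p(1)] in simp)
    ultimately show "finite {B \<in> T ` P. A \<inter> B \<noteq> {}}" by (rule finite_subset)
  qed
  moreover have "closed (C \<union> \<Union>(T ` P))"
    unfolding closed_def
  proof (rule open_subopen[THEN iffD2], intro ballI)
    fix x assume "x \<in> - (C \<union> \<Union>(T ` P))"
    then have x: "0 < \<delta> x" "x \<notin> \<Union>(T ` P)" using pos by auto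
    \<comment> \<open>A tile around \<open>p\<close> that meets
      \<open>ball x (\<delta> x / 4)\<close> satisfies
      \<open>3/4 * \<delta> x \<le> 5/3 * \<delta> p\<close>, hence belongs to the finite set
      \<open>Q\<close>. Removing these finitely many closed balls leaves a neighbourhood of
      \<open>x\<close>.\<close>
    define Q where "Q = {p\<in>P. \<delta> x / 4 \<le> \<delta> p}"
    define U where "U = ball x (\<delta> x / 4) - \<Union>(T ` Q)"
    have "finite Q" unfolding Q_def by (rule fin) (use x in simp)
    then have "open U"
      unfolding U_def T_def by (intro open_Diff closed_UN) auto
    moreover have "x \<in> U" using x by (auto simp: U_def Q_def)
    moreover have "U \<subseteq> - (C \<union> \<Union>(T ` P))"
    proof -
      have "y \<notin> C" if "y \<in> U" for y
        using that far[of y x] x by (auto simp: U_def)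
      moreover have "y \<notin> T p" if "y \<in> U" "p \<in> P" for y p
      proof
        assume y: "y \<in> T p"
        have "dist x p \<le> \<delta> x / 4 + 2 / 3 * \<delta> p"
          using near[OF that(2) y] that(1) dist_triangle2[of x p y] by (auto simp: U_def)
        then have "p \<in> Q" using lip[of x p] that x by (auto simp: Q_def)
        then show False using y that by (auto simp: U_def)
      qed
      ultimately show ?thesis by blast
    qed
    ultimately show "\<exists>U. open U \<and> x \<in> U \<and> U \<subseteq> - (C \<union> \<Union>(T ` P))" by blast
  qed
  moreover have "K \<subseteq> C \<union> \<Union>(T ` P)"
  proof
    fix z assume z: "z \<in> K"
    show "z \<in> C \<union> \<Union>(T ` P)"
    proof (cases "z \<in> C")
      case False
      then obtain p where p: "p \<in> P" "dist p z < r p"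
        using net[OF z] pos by (auto simp: r_def)
      then have "p \<in> K" using P(1) by blast
      have "norm (lsnd (c p) - lsnd z) \<le> r p"
      proof (rule norm_c00_leI)
        fix k
        show "\<bar>c00_nth (lsnd (c p) - lsnd z) k\<bar> \<le> r p"
        \<comment> \<open>Below \<open>N\<close> the shifted center agrees with \<open>p\<close>;
          from \<open>N\<close> on \<open>z\<close> vanishes and the center has coordinates of size
          at most \<open>r p\<close>.\<close>
        proof (cases "k < N")
          case True
          have "\<bar>c00_nth (lsnd p - lsnd z) k\<bar> \<le> r p"
            using abs_c00_nth_le_norm[of "lsnd p - lsnd z" k] p(2)
            unfolding dist_linf_sum_eq dist_norm by linarith
          then show ?thesis using True by (simp add: c_def s_def c00_nth_separator)
        next
          case False
          then show ?thesis
            using z \<open>p \<in> K\<close> r[OF p(1)] by (simp add: c_def s_def c00_nth_separator N)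
        qed
      qed
      then have "z \<in> T p" using p(2) by (simp add: T_def c_def dist_linf_sum_eq dist_norm)
      then show ?thesis using p(1) by blast
    qed simp
  qed
  ultimately show ?thesis
    using away by (intro exI[of _ "T ` P"]) blast
qed

section \<open>Gluing the stages\<close>

text \<open>Tiles of different stages are disjoint, so non-overlap and star-finiteness only have to
  be checked within a single stage.\<close>

lemma star_finite_tiling_from_stages:
  fixes K :: "nat \<Rightarrow> ('a::real_normed_vector) set"
  assumes cover: "(\<Union>n. K n) = UNIV"
    and stage: "\<And>C n. closed C \<Longrightarrow> \<exists>G. (\<forall>A\<in>G. is_ball A \<and> A \<inter> C = {}) \<and> non_overlapping G \<and>
      star_finite G \<and> closed (C \<union> \<Union>G) \<and> K n \<subseteq> C \<union> \<Union>G"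
  shows "\<exists>F :: 'a set set. tiling_by_balls F \<and> star_finite F"
proof -
  \<comment> \<open>With closedness as a premise inside the existential, the choice function
    \<open>g\<close> is total and can drive the recursion before \<open>C n\<close> is known to be
    closed.\<close>
  have "\<forall>C n. \<exists>G. closed C \<longrightarrow> (\<forall>A\<in>G. is_ball A \<and> A \<inter> C = {}) \<and> non_overlapping G \<and>
      star_finite G \<and> closed (C \<union> \<Union>G) \<and> K n \<subseteq> C \<union> \<Union>G"
    using stage by meson
  then obtain g where g: "\<And>C n. closed C \<Longrightarrow> (\<forall>A\<in>g C n. is_ball A \<and> A \<inter> C = {}) \<and>
      non_overlapping (g C n) \<and> star_finite (g C n) \<and> closed (C \<union> \<Union>(g C n)) \<and> K n \<subseteq> C \<union> \<Union>(g C n)"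
    by metis
  define C where "C = rec_nat {} (\<lambda>n C. C \<union> \<Union>(g C n))"
  define G where "G n = g (C n) n" for n
  have C_Suc: "C (Suc n) = C n \<union> \<Union>(G n)" and C_0: "C 0 = {}" for n
    by (simp_all add: C_def G_def)
  have "closed (C n)" for n
    by (induction n) (use g in \<open>auto simp: C_0 C_Suc G_def\<close>)
  then have G: "\<And>n A. A \<in> G n \<Longrightarrow> is_ball A" "\<And>n A. A \<in> G n \<Longrightarrow> A \<inter> C n = {}"
    "\<And>n. non_overlapping (G n)" "\<And>n. star_finite (G n)" "\<And>n. K n \<subseteq> C (Suc n)"
    using g unfolding C_Suc G_def by blast+
  have "C m \<subseteq> C n" if "m \<le> n" for m n
    using that by (rule lift_Suc_mono_le[rotated]) (auto simp: C_Suc)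
  then have "A \<inter> B = {}" if "A \<in> G m" "B \<in> G n" "m < n" for A B m n
    using that G(2)[of B n] C_Suc[of m] by (metis (no_types, lifting) Suc_leI Sup_upper Un_upper2
        disjoint_iff subset_eq)
  then have cross: "m = n" if "A \<in> G m" "B \<in> G n" "A \<inter> B \<noteq> {}" for A B m n
    using that by (metis inf_commute nat_neq_iff)
  define F where "F = (\<Union>n. G n)"
  have "C n \<subseteq> \<Union>F" for n
    by (induction n) (auto simp: C_0 C_Suc F_def)
  then have "\<Union>F = UNIV" using cover G(5) by blast
  moreover have "disjnt (interior A) (interior B)" if AB: "A \<in> F" "B \<in> F" "A \<noteq> B" for A B
  proof (cases "A \<inter> B = {}")
    case True
    then show ?thesis using interior_subset[of A] interior_subset[of B] by (auto simp: disjnt_iff)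
  next
    case False
    moreover obtain m n where "A \<in> G m" "B \<in> G n" using AB by (auto simp: F_def)
    ultimately have "A \<in> G n" "B \<in> G n" using cross by blast+
    then show ?thesis using G(3)[of n] AB(3) by (auto simp: non_overlapping_def pairwise_def)
  qed
  then have "non_overlapping F" by (auto simp: non_overlapping_def pairwise_def)
  moreover have "\<forall>A\<in>F. is_ball A" using G(1) by (auto simp: F_def)
  moreover have "star_finite F"
    unfolding star_finite_def
  proof
    fix A assume "A \<in> F"
    then obtain n where n: "A \<in> G n" by (auto simp: F_def)
    then have "{B \<in> F. A \<inter> B \<noteq> {}} \<subseteq> {B \<in> G n. A \<inter> B \<noteq> {}}"
      using cross by (auto simp: F_def) blast
    moreover have "finite {B \<in> G n. A \<inter> B \<noteq> {}}"
      using G(4)[of n] n by (simp add: star_finite_def)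
    ultimately show "finite {B \<in> F. A \<inter> B \<noteq> {}}" by (rule finite_subset)
  qed
  ultimately show ?thesis unfolding tiling_by_balls_iff by blast
qed

lemma star_finite_tiling_c00:
  assumes "countable_algebraic_dimension TYPE('a::real_normed_vector)"
  shows "\<exists>F :: ('a \<oplus>\<^sub>\<infinity> c00) set set. tiling_by_balls F \<and> star_finite F"
proof -
  obtain B :: "'a set" where B: "span B = UNIV" "countable B"
    using assms by (auto simp: countable_algebraic_dimension_def)
  define S where "S = (\<lambda>x. linf_pair x 0) ` B \<union> linf_pair 0 ` range c00_unit"
  have "span S = UNIV" "countable S"
    using span_linf_sum[OF B(1) span_c00_units] B(2) by (simp_all add: S_def)
  then obtain K :: "nat \<Rightarrow> ('a \<oplus>\<^sub>\<infinity> c00) set" where K: "(\<Union>n. K n) = UNIV"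
    "\<And>n. compact (K n)" "\<And>n. \<exists>T. finite T \<and> K n \<subseteq> span T"
    using countable_span_compact_cover[of S] by metis
  have "\<exists>N. \<forall>z\<in>K n. \<forall>k\<ge>N. c00_nth (lsnd z) k = 0" for n
  proof -
    obtain T where T: "finite T" "K n \<subseteq> span T" using K(3) by blast
    have "\<forall>z :: 'a \<oplus>\<^sub>\<infinity> c00. \<exists>N. \<forall>k\<ge>N. c00_nth (lsnd z) k = 0"
      using c00_nth_eventually_zero by blast
    then obtain M where M: "\<And>z :: 'a \<oplus>\<^sub>\<infinity> c00. \<forall>k\<ge>M z. c00_nth (lsnd z) k = 0"
      by metis
    \<comment> \<open>From \<open>N\<close> on all vectors of \<open>T\<close> vanish, hence so does
      their span and with it \<open>K n\<close>. The inserted 0 covers the case of empty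
      \<open>T\<close>.\<close>
    define N where "N = Max (insert 0 (M ` T))"
    have "M z \<le> N" if "z \<in> T" for z
      unfolding N_def using T(1) that by (intro Max_ge) auto
    then have "T \<subseteq> {z. \<forall>k\<ge>N. c00_nth (lsnd z) k = 0}"
      using M order_trans by blast
    moreover have "subspace {z :: 'a \<oplus>\<^sub>\<infinity> c00. \<forall>k\<ge>N. c00_nth (lsnd z) k = 0}"
      by (auto simp: subspace_def)
    ultimately show ?thesis using T(2) span_minimal by blast
  qed
  then obtain N where N: "\<And>n z k. z \<in> K n \<Longrightarrow> N n \<le> k \<Longrightarrow> c00_nth (lsnd z) k = 0"
    by metis
  show ?thesis
    by (rule star_finite_tiling_from_stages[OF K(1) star_finite_stage[OF _ K(2) N]])
qed

theorem theoremB: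
  assumes nontrivial: "\<exists>x :: 'a::real_normed_vector. x \<noteq> 0"
    and separable: "separable_space (euclidean :: 'a topology)"
  shows "((\<exists>F :: ('a \<oplus>\<^sub>\<infinity> c0) set set. tiling_by_balls F) \<longleftrightarrow>
            (\<exists>F :: 'a set set. tiling_by_balls F)) \<and>
         (countable_algebraic_dimension TYPE('a) \<longrightarrow>
            (\<exists>F :: ('a \<oplus>\<^sub>\<infinity> c00) set set. tiling_by_balls F \<and> star_finite F))"
  using tiling_by_balls_slice[OF separable] tiling_by_balls_product_c0 star_finite_tiling_c00
  by blast

end
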